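(* Let $G$ be a graph of order $n$ and maximum degree $\Delta(G)$. If $H$ is a graph of order $n'$ such that $n'-\gamma_{\rm sp}(H)>\Delta(G)+1$, then $$\gamma_{\rm sp}(G\circ H)=\alpha(G)\,\gamma_{\rm sp}(H)+(n-\alpha(G))\,n'.$$
   Context: All graphs are finite, simple and undirected, with nonempty vertex set; the order of a graph is its number of vertices. For a vertex $v$ of $G$, $N(v)$ is the set of vertices adjacent to $v$, and for $D\subseteq V(G)$, $\overline{D}=V(G)\setminus D$. A set $D\subseteq V(G)$ is a super dominating set of $G$ if for every $u\in\overline{D}$ there exists $v\in D$ such that $N(v)\cap\overline{D}=\{u\}$. The super domination number $\gamma_{\rm sp}(G)$ is the minimum cardinality of a super dominating set of $G$. The lexicographic product $G\circ H$ has vertex set $V(G)\times V(H)$, and $(g,h)$ is adjacent to $(g',h')$ if and only if $gg'\in E(G)$, or $g=g'$ and $hh'\in E(H)$. $\alpha(G)$ is the independence number of $G$. *)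

theory Defs
  imports "Graph_Theory.Pair_Digraph"
begin

text \<open>
  Finite simple undirected graphs are the structures satisfying \<open>pair_graph\<close>: finite, loop-free,
  symmetric arc relations. An undirected edge \<open>uv\<close> is thus stored as the two arcs \<open>(u, v)\<close> and
  \<open>(v, u)\<close>, so \<open>out_degree\<close> counts every edge at a vertex exactly once.
\<close>

definition nbhd :: "'a pair_pre_digraph \<Rightarrow> 'a \<Rightarrow> 'a set" where
  "nbhd G v = {u. (v, u) \<in> parcs G}"

definition max_degree :: "'a pair_pre_digraph \<Rightarrow> nat" where
  "max_degree G = Max (out_degree (with_proj G) ` pverts G)"

definition independent_set :: "'a pair_pre_digraph \<Rightarrow> 'a set \<Rightarrow> bool" where
  "independent_set G S \<longleftrightarrow> S \<subseteq> pverts G \<and> (\<forall>u\<in>S. \<forall>v\<in>S. (u, v) \<notin> parcs G)"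

definition independence_number :: "'a pair_pre_digraph \<Rightarrow> nat" where
  "independence_number G = Max (card ` {S. independent_set G S})"

definition super_dominating :: "'a pair_pre_digraph \<Rightarrow> 'a set \<Rightarrow> bool" where
  "super_dominating G D \<longleftrightarrow> D \<subseteq> pverts G \<and>
     (\<forall>u \<in> pverts G - D. \<exists>v\<in>D. nbhd G v \<inter> (pverts G - D) = {u})"

definition super_domination_number :: "'a pair_pre_digraph \<Rightarrow> nat" where
  "super_domination_number G = Min (card ` {D. super_dominating G D})"

definition lex_product ::
  "'a pair_pre_digraph \<Rightarrow> 'b pair_pre_digraph \<Rightarrow> ('a \<times> 'b) pair_pre_digraph" where
  "lex_product G H =
     \<lparr> pverts = pverts G \<times> pverts H,
       parcs = {((g, h), (g', h')) | g h g' h'.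
                  (g, h) \<in> pverts G \<times> pverts H \<and> (g', h') \<in> pverts G \<times> pverts H \<and>
                  ((g, g') \<in> parcs G \<or> g = g' \<and> (h, h') \<in> parcs H)} \<rparr>"

lemma out_degree_eq_card_nbhd: "out_degree (with_proj G) v = card (nbhd G v)"
proof -
  have "out_arcs (with_proj G) v = Pair v ` nbhd G v"
    by (auto simp: out_arcs_def nbhd_def)
  then show ?thesis
    by (simp add: out_degree_def card_image inj_on_def)
qed

lemma pair_graph_lex_product:
  assumes "pair_graph G" "pair_graph H"
  shows "pair_graph (lex_product G H)"
proof -
  interpret G: pair_graph G by fact
  interpret H: pair_graph H by fact
  let ?V = "pverts G \<times> pverts H"
  have fin: "finite ?V" by simp
  have "finite (parcs (lex_product G H))"
    by (rule finite_subset[of _ "?V \<times> ?V"]) (auto simp: lex_product_def)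
  moreover have "symmetric (with_proj (lex_product G H))"
    using G.sym_arcs H.sym_arcs
    by (auto simp: symmetric_def lex_product_def sym_def)
  ultimately show ?thesis
    using fin G.no_loops H.no_loops
    by unfold_locales (auto simp: lex_product_def)
qed

text \<open>The next two facts ensure that the natural-number differences \<open>n - \<alpha>(G)\<close> and
  \<open>n' - \<gamma>\<^sub>s\<^sub>p(H)\<close> are never truncated.\<close>

lemma independence_number_le_order:
  assumes "finite (pverts G)"
  shows "independence_number G \<le> card (pverts G)"
proof -
  have "finite {S. independent_set G S}"
    by (rule finite_subset[of _ "Pow (pverts G)"]) (auto simp: independent_set_def assms)
  moreover have "card S \<le> card (pverts G)" if "independent_set G S" for S
    using that assms by (auto simp: independent_set_def intro: card_mono)
  moreover have "independent_set G {}" by (simp add: independent_set_def)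
  ultimately show ?thesis
    unfolding independence_number_def
    by (subst Max_le_iff) auto
qed

lemma super_domination_number_le_order:
  assumes "finite (pverts G)"
  shows "super_domination_number G \<le> card (pverts G)"
proof -
  have "finite {D. super_dominating G D}"
    by (rule finite_subset[of _ "Pow (pverts G)"]) (auto simp: super_dominating_def assms)
  moreover have "super_dominating G (pverts G)" by (simp add: super_dominating_def)
  ultimately show ?thesis
    unfolding super_domination_number_def by (intro Min_le) auto
qed

end

theory Submission
  imports Defs
begin

text \<open>
  It is convenient to count the vertices \<^emph>\<open>outside\<close> a super dominating set. With
  \<open>m = n' - \<gamma>\<^sub>s\<^sub>p(H)\<close>, the greatest number of vertices that a super dominating set of \<open>H\<close>
  can leave out, the claim says that a super dominating set of the product can leave out at most
  \<open>\<alpha>(G) * m\<close> vertices, and that this many can be reached.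

  Reaching it is easy: over each vertex of a maximum independent set of \<open>G\<close>, leave out a copy of
  the complement of a minimum super dominating set of \<open>H\<close>. The layers involved do not see each
  other, so each of them can be dominated from inside
  (\<open>super_dominating_lex_product_over_independent\<close>).

  Conversely, let \<open>U\<close> be the complement of a super dominating set of the product. A vertex of the
  product is adjacent to all or nothing of any layer but its own, so a layer that meets \<open>U\<close> in two
  or more vertices must be dominated from inside. Such a layer therefore loses at most \<open>m\<close> vertices,
  and all neighbouring layers lose none (\<open>large_fibre_super_dominating\<close>,
  \<open>large_fibre_isolated\<close>). The other layers lose at most one vertex each, and among the set \<open>C\<close> of
  those that lose exactly one there is an independent set \<open>I\<close> with \<open>\<bar>C\<bar> \<le> (\<Delta>(G) + 1) \<bar>I\<bar>\<close>. If \<open>B\<close> is the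
  set of layers that lose two or more, then \<open>B \<union> I\<close> is independent, and \<open>\<Delta>(G) + 1 \<le> m\<close> gives
  \<open>\<bar>U\<bar> \<le> m \<bar>B\<bar> + \<bar>C\<bar> \<le> m \<bar>B \<union> I\<bar> \<le> \<alpha>(G) * m\<close> (\<open>card_complement_super_dominating_lex_product_le\<close>).
\<close>

section \<open>Neighbourhoods and extremal sets\<close>

lemma nbhd_subset_pverts:
  assumes "pair_graph G"
  shows "nbhd G v \<subseteq> pverts G"
proof -
  interpret pair_graph G by fact
  show ?thesis by (auto simp: nbhd_def dest: in_arcsD2)
qed

lemma nbhd_sym:
  assumes "pair_graph G"
  shows "u \<in> nbhd G v \<longleftrightarrow> v \<in> nbhd G u"
proof -
  interpret pair_graph G by fact
  show ?thesis by (auto simp: nbhd_def intro: arcs_symmetric)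
qed

lemma not_in_own_nbhd:
  assumes "pair_graph G"
  shows "v \<notin> nbhd G v"
proof -
  interpret pair_graph G by fact
  show ?thesis using no_loops by (fastforce simp: nbhd_def)
qed

lemma card_nbhd_le_max_degree:
  assumes "pair_graph G" "v \<in> pverts G"
  shows "card (nbhd G v) \<le> max_degree G"
proof -
  interpret pair_graph G by fact
  show ?thesis
    unfolding max_degree_def out_degree_eq_card_nbhd[symmetric]
    using assms(2) by (intro Max_ge) auto
qed

lemma pverts_lex_product: "pverts (lex_product G H) = pverts G \<times> pverts H"
  by (simp add: lex_product_def)

lemma nbhd_lex_product:
  assumes "pair_graph G" "pair_graph H" "g \<in> pverts G" "h \<in> pverts H"
  shows "nbhd (lex_product G H) (g, h) = nbhd G g \<times> pverts H \<union> {g} \<times> nbhd H h"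
  using assms(3,4) nbhd_subset_pverts[OF assms(1), of g] nbhd_subset_pverts[OF assms(2), of h]
  by (auto simp: lex_product_def nbhd_def)

lemma independent_set_iff_nbhd:
  "independent_set G S \<longleftrightarrow> S \<subseteq> pverts G \<and> (\<forall>u\<in>S. nbhd G u \<inter> S = {})"
  by (auto simp: independent_set_def nbhd_def)

lemma finite_independent_sets:
  assumes "finite (pverts G)"
  shows "finite {S. independent_set G S}"
  by (rule finite_subset[of _ "Pow (pverts G)"]) (auto simp: independent_set_def assms)

lemma finite_super_dominating_sets:
  assumes "finite (pverts G)"
  shows "finite {D. super_dominating G D}"
  by (rule finite_subset[of _ "Pow (pverts G)"]) (auto simp: super_dominating_def assms)

lemma maximum_independent_set_exists:
  assumes "finite (pverts G)"
  obtains S where "independent_set G S" "card S = independence_number G"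
proof -
  have "independent_set G {}" by (simp add: independent_set_def)
  then have "independence_number G \<in> card ` {S. independent_set G S}"
    unfolding independence_number_def using finite_independent_sets[OF assms]
    by (intro Max_in) auto
  then show thesis using that by auto
qed

lemma minimum_super_dominating_set_exists:
  assumes "finite (pverts G)"
  obtains D where "super_dominating G D" "card D = super_domination_number G"
proof -
  have "super_dominating G (pverts G)" by (simp add: super_dominating_def)
  then have "super_domination_number G \<in> card ` {D. super_dominating G D}"
    unfolding super_domination_number_def using finite_super_dominating_sets[OF assms]
    by (intro Min_in) auto
  then show thesis using that by auto
qed

lemma card_independent_set_le:
  assumes "finite (pverts G)" "independent_set G S"
  shows "card S \<le> independence_number G"
  unfolding independence_number_def
  using assms(2) finite_independent_sets[OF assms(1)] by (intro Max_ge) auto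

lemma super_domination_number_le:
  assumes "finite (pverts G)" "super_dominating G D"
  shows "super_domination_number G \<le> card D"
  unfolding super_domination_number_def
  using assms(2) finite_super_dominating_sets[OF assms(1)] by (intro Min_le) auto

section \<open>Leaving out layers over an independent set\<close>

text \<open>
  A layer over a vertex of \<open>A\<close> has only full layers as neighbours, so a vertex that
  has a single neighbour outside \<open>D\<close> within its copy of \<open>H\<close> gains no further such neighbour in the
  product.
\<close>

lemma super_dominating_lex_product_over_independent:
  assumes G: "pair_graph G" and H: "pair_graph H"
    and A: "independent_set G A" and D: "super_dominating H D"
  shows "super_dominating (lex_product G H) (pverts G \<times> pverts H - A \<times> (pverts H - D))"
    (is "super_dominating ?P ?E")
proof -
  have AG: "A \<subseteq> pverts G" and DH: "D \<subseteq> pverts H"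
    using A D by (auto simp: independent_set_def super_dominating_def)
  have compl: "pverts ?P - ?E = A \<times> (pverts H - D)"
    using AG by (auto simp: pverts_lex_product)
  have "\<exists>v\<in>?E. nbhd ?P v \<inter> (A \<times> (pverts H - D)) = {(g, h)}"
    if g: "g \<in> A" and h: "h \<in> pverts H - D" for g h
  proof -
    obtain k where k: "k \<in> D" "nbhd H k \<inter> (pverts H - D) = {h}"
      using D h unfolding super_dominating_def by blast
    have "nbhd G g \<inter> A = {}"
      using A g by (simp add: independent_set_iff_nbhd)
    then have "nbhd ?P (g, k) \<inter> (A \<times> (pverts H - D)) = {(g, h)}"
      using k g AG DH by (subst nbhd_lex_product[OF G H]) auto
    moreover have "(g, k) \<in> ?E" using g k AG DH by auto
    ultimately show ?thesis by blast
  qed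
  then show ?thesis
    unfolding super_dominating_def compl by (auto simp: pverts_lex_product)
qed

section \<open>Layers with many vertices outside a super dominating set\<close>

text \<open>
  If the layer over \<open>g\<close> meets the complement of \<open>D\<close> in at least two vertices, none of them can be the
  private neighbour of a vertex in another layer, since that vertex would see all of them. So its
  dominating vertex lies in the same layer. This vertex also sees the whole of every layer
  over a neighbour of \<open>g\<close>, so these layers must lie in \<open>D\<close>.
\<close>

lemma large_fibre_dominated_from_inside:
  assumes G: "pair_graph G" and H: "pair_graph H"
    and D: "super_dominating (lex_product G H) D"
    and U: "U = pverts G \<times> pverts H - D"
    and large: "1 < card (U `` {g})"
    and h: "h \<in> U `` {g}"
  obtains k where "k \<in> pverts H - U `` {g}" "nbhd H k \<inter> U `` {g} = {h}"
    "nbhd G g \<times> pverts H \<inter> U = {}"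
proof -
  let ?P = "lex_product G H"
  have "(g, h) \<in> pverts ?P - D" and compl: "pverts ?P - D = U"
    using h U by (auto simp: pverts_lex_product)
  then have "\<exists>v\<in>D. nbhd ?P v \<inter> U = {(g, h)}"
    using D unfolding super_dominating_def compl by blast
  then obtain g' k where v: "(g', k) \<in> D" "nbhd ?P (g', k) \<inter> U = {(g, h)}"
    by auto
  have g': "g' \<in> pverts G" and k: "k \<in> pverts H"
    using v(1) D by (auto simp: super_dominating_def pverts_lex_product)
  have nbhd: "nbhd ?P (g', k) = nbhd G g' \<times> pverts H \<union> {g'} \<times> nbhd H k"
    by (rule nbhd_lex_product[OF G H g' k])
  have mem: "(g, h) \<in> nbhd ?P (g', k)"
    and only: "\<And>x. x \<in> nbhd ?P (g', k) \<Longrightarrow> x \<in> U \<Longrightarrow> x = (g, h)"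
    using v(2) by blast+
  have "g \<notin> nbhd G g'"
  proof
    assume "g \<in> nbhd G g'"
    have "U `` {g} \<subseteq> {h}"
    proof
      fix h' assume "h' \<in> U `` {g}"
      then have "(g, h') \<in> U" by simp
      moreover have "(g, h') \<in> nbhd ?P (g', k)"
        using \<open>g \<in> nbhd G g'\<close> \<open>(g, h') \<in> U\<close> unfolding nbhd U by simp
      ultimately show "h' \<in> {h}" using only by blast
    qed
    then have "card (U `` {g}) \<le> 1" using card_mono[of "{h}"] by simp
    then show False using large by simp
  qed
  with mem have "g' = g" and hk: "h \<in> nbhd H k" unfolding nbhd by auto
  have "nbhd H k \<inter> U `` {g} = {h}"
  proof
    show "nbhd H k \<inter> U `` {g} \<subseteq> {h}"
      using only unfolding nbhd unfolding \<open>g' = g\<close> by auto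
    show "{h} \<subseteq> nbhd H k \<inter> U `` {g}" using hk h by simp
  qed
  moreover have "nbhd G g \<times> pverts H \<inter> U = {}"
    using only not_in_own_nbhd[OF G, of g] unfolding nbhd unfolding \<open>g' = g\<close> by blast
  moreover have "k \<in> pverts H - U `` {g}"
    using k v(1) unfolding U \<open>g' = g\<close> by simp
  ultimately show thesis using that by blast
qed

lemma large_fibre_super_dominating:
  assumes "pair_graph G" and "pair_graph H"
    and "super_dominating (lex_product G H) D"
    and U: "U = pverts G \<times> pverts H - D"
    and "1 < card (U `` {g})"
  shows "super_dominating H (pverts H - U `` {g})"
proof -
  have "pverts H - (pverts H - U `` {g}) = U `` {g}" using U by auto
  moreover have "\<exists>k\<in>pverts H - U `` {g}. nbhd H k \<inter> U `` {g} = {h}" if "h \<in> U `` {g}" for h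
    by (rule large_fibre_dominated_from_inside[OF assms that]) blast
  ultimately show ?thesis
    unfolding super_dominating_def by simp
qed

lemma large_fibre_isolated:
  assumes "pair_graph G" and "pair_graph H"
    and "super_dominating (lex_product G H) D"
    and U: "U = pverts G \<times> pverts H - D"
    and "1 < card (U `` {g})"
    and g': "g' \<in> nbhd G g"
  shows "U `` {g'} = {}"
proof -
  obtain h where "h \<in> U `` {g}"
    using assms(5) by (cases "U `` {g} = {}") auto
  from large_fibre_dominated_from_inside[OF assms(1-5) this]
  have "nbhd G g \<times> pverts H \<inter> U = {}" by blast
  then show ?thesis using U g' by auto
qed

section \<open>The upper bound on the complement\<close>

text \<open>
  Any maximal independent subset \<open>I\<close> of \<open>C\<close> will do: by maximality the closed neighbourhoods of its
  members cover \<open>C\<close>, and each has at most \<open>\<Delta>(G) + 1\<close> elements.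
\<close>

lemma large_independent_subset_exists:
  assumes G: "pair_graph G" and C: "C \<subseteq> pverts G"
  obtains I where "I \<subseteq> C" "independent_set G I" "card C \<le> (max_degree G + 1) * card I"
proof -
  interpret pair_graph G by fact
  let ?F = "{I. independent_set G I \<and> I \<subseteq> C}"
  have "finite ?F" by (rule finite_subset[OF _ finite_independent_sets]) auto
  moreover have "{} \<in> ?F" by (simp add: independent_set_def)
  ultimately have "\<exists>I\<in>?F. \<forall>J\<in>?F. I \<subseteq> J \<longrightarrow> I = J"
    by (intro finite_has_maximal) auto
  then obtain I where I: "I \<in> ?F" and maximal: "\<And>J. J \<in> ?F \<Longrightarrow> I \<subseteq> J \<Longrightarrow> I = J"
    by (auto simp only: Ball_def)
  have IG: "I \<subseteq> pverts G" and indep: "\<forall>u\<in>I. nbhd G u \<inter> I = {}"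
    using I by (auto simp: independent_set_iff_nbhd)
  have fin_nbhd: "finite (nbhd G i)" for i
    using nbhd_subset_pverts[OF G] finite_verts by (metis finite_subset with_proj_simps(1))
  have "C \<subseteq> (\<Union>i\<in>I. insert i (nbhd G i))"
  proof
    fix c assume c: "c \<in> C"
    show "c \<in> (\<Union>i\<in>I. insert i (nbhd G i))"
    proof (rule ccontr)
      assume uncovered: "c \<notin> (\<Union>i\<in>I. insert i (nbhd G i))"
      then have "nbhd G c \<inter> I = {}" using nbhd_sym[OF G] by auto
      then have "independent_set G (insert c I)"
        using uncovered indep IG c C not_in_own_nbhd[OF G, of c]
        by (auto simp: independent_set_iff_nbhd)
      then have "I = insert c I" using I c by (intro maximal) auto
      then show False using uncovered by auto
    qed
  qed
  moreover have fin_I: "finite I" by (rule finite_subset[OF IG]) simp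
  ultimately have "card C \<le> card (\<Union>i\<in>I. insert i (nbhd G i))"
    using fin_nbhd by (intro card_mono) auto
  also have "\<dots> \<le> (\<Sum>i\<in>I. card (insert i (nbhd G i)))"
    by (rule card_UN_le[OF fin_I])
  also have "\<dots> \<le> (\<Sum>i\<in>I. max_degree G + 1)"
  proof (rule sum_mono)
    fix i assume "i \<in> I"
    then have "card (nbhd G i) \<le> max_degree G"
      using card_nbhd_le_max_degree[OF G] IG by auto
    then show "card (insert i (nbhd G i)) \<le> max_degree G + 1"
      using card_insert_le_m1[of "max_degree G + 1" "nbhd G i" i] by simp
  qed
  also have "\<dots> = (max_degree G + 1) * card I" by simp
  finally show thesis using that I by blast
qed

text \<open>
  The layers that lose one vertex may be adjacent to each other, when they are dominated from
  neighbouring layers. The assumption \<open>max_degree G + 1 \<le> m\<close> makes this unprofitable: passing from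
  them to an independent subset divides their number by at most \<open>m\<close>, while each layer that is kept
  is charged with \<open>m\<close> vertices instead of one.
\<close>

lemma card_complement_super_dominating_lex_product_le:
  assumes G: "pair_graph G" and H: "pair_graph H"
    and D: "super_dominating (lex_product G H) D"
    and m: "m = card (pverts H) - super_domination_number H"
    and deg: "max_degree G + 1 \<le> m"
  shows "card (pverts G \<times> pverts H - D) \<le> independence_number G * m"
proof -
  interpret G: pair_graph G by fact
  interpret H: pair_graph H by fact
  define U where "U = pverts G \<times> pverts H - D"
  define B where "B = {g \<in> pverts G. 1 < card (U `` {g})}"
  define C where "C = {g \<in> pverts G. card (U `` {g}) = 1}"
  note isolated = large_fibre_isolated[OF G H D U_def]
  have fin: "finite (pverts G)" "finite (pverts H)" by simp_all
  have fibre: "U `` {g} \<subseteq> pverts H" for g by (auto simp: U_def)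
  have fin_fibre: "finite (U `` {g})" for g
    using fibre fin(2) by (rule finite_subset)

  have fibre_le: "card (U `` {g}) \<le> m" if "g \<in> B" for g
  proof -
    have "super_domination_number H \<le> card (pverts H - U `` {g})"
      using that large_fibre_super_dominating[OF G H D U_def, of g]
      by (intro super_domination_number_le) (auto simp: B_def)
    also have "\<dots> = card (pverts H) - card (U `` {g})"
      using fibre fin_fibre by (simp add: card_Diff_subset)
    finally show ?thesis
      using card_mono[OF fin(2) fibre[of g]] unfolding m by linarith
  qed

  obtain I where I: "I \<subseteq> C" "independent_set G I" "card C \<le> (max_degree G + 1) * card I"
    using large_independent_subset_exists[OF G, of C] by (auto simp: C_def)
  have BI: "B \<inter> I = {}" and fin_BI: "finite B" "finite I"
    using I(1) fin(1) finite_subset[OF I(1)] by (auto simp: B_def C_def)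
  have no_nbr: "nbhd G b \<inter> (B \<union> C) = {}" if "b \<in> B" for b
  proof -
    have "card (U `` {g}) = 0" if "g \<in> nbhd G b" for g
      using isolated[of b g] that \<open>b \<in> B\<close> unfolding B_def by simp
    then show ?thesis unfolding B_def C_def by force
  qed
  have "independent_set G (B \<union> I)"
    unfolding independent_set_iff_nbhd
  proof (intro conjI ballI)
    show "B \<union> I \<subseteq> pverts G" using I(2) by (auto simp: B_def independent_set_def)
    fix u assume u: "u \<in> B \<union> I"
    show "nbhd G u \<inter> (B \<union> I) = {}"
    proof (cases "u \<in> B")
      case True
      then show ?thesis using no_nbr I(1) by blast
    next
      case False
      then have "u \<in> I" using u by blast
      then have "nbhd G u \<inter> I = {}" using I(2) by (simp add: independent_set_iff_nbhd)
      moreover have "nbhd G u \<inter> B = {}"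
        using no_nbr I(1) \<open>u \<in> I\<close> nbhd_sym[OF G, of _ u] by blast
      ultimately show ?thesis by blast
    qed
  qed
  then have alpha: "card B + card I \<le> independence_number G"
    using card_independent_set_le[of G "B \<union> I"] fin(1) BI fin_BI by (simp add: card_Un_disjoint)

  have "U = Sigma (pverts G) (\<lambda>g. U `` {g})" by (auto simp: U_def)
  then have "card U = (\<Sum>g\<in>pverts G. card (U `` {g}))"
    using card_SigmaI[OF fin(1), of "\<lambda>g. U `` {g}"] fin_fibre by simp
  also have "\<dots> \<le> (\<Sum>g\<in>pverts G. (if g \<in> B then m else 0) + (if g \<in> C then 1 else 0))"
  proof (rule sum_mono)
    fix g assume "g \<in> pverts G"
    then consider "g \<in> B" | "g \<in> C" | "card (U `` {g}) = 0"
      unfolding B_def C_def by fastforce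
    then show "card (U `` {g}) \<le> (if g \<in> B then m else 0) + (if g \<in> C then 1 else 0)"
    proof cases
      case 1
      then show ?thesis using fibre_le[of g] by simp
    qed (simp_all add: C_def)
  qed
  also have "\<dots> = card B * m + card C"
  proof -
    have "pverts G \<inter> B = B" "pverts G \<inter> C = C" by (auto simp: B_def C_def)
    then show ?thesis using fin(1)
      by (simp add: sum.distrib flip: sum.inter_restrict)
  qed
  also have "\<dots> \<le> card B * m + m * card I"
    using I(3) mult_le_mono1[OF deg, of "card I"] by linarith
  also have "\<dots> = (card B + card I) * m" by (simp add: algebra_simps)
  also have "\<dots> \<le> independence_number G * m" using alpha by (rule mult_le_mono1)
  finally show ?thesis by (simp add: U_def)
qed

section \<open>The super domination number of the product\<close>

theorem theorem14:
  fixes G :: "'a pair_pre_digraph" and H :: "'b pair_pre_digraph" and n n' :: nat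
  assumes "pair_graph G" and "pverts G \<noteq> {}" and "card (pverts G) = n"
    and "pair_graph H" and "pverts H \<noteq> {}" and "card (pverts H) = n'"
    and "n' - super_domination_number H > max_degree G + 1"
  shows "super_domination_number (lex_product G H) =
    independence_number G * super_domination_number H + (n - independence_number G) * n'"
proof -
  interpret G: pair_graph G by fact
  interpret H: pair_graph H by fact
  let ?P = "lex_product G H"
  let ?a = "independence_number G" and ?s = "super_domination_number H"
  have fin: "finite (pverts G)" "finite (pverts H)" by simp_all
  then have finP: "finite (pverts ?P)" by (simp add: pverts_lex_product)
  have a: "?a \<le> n" and s: "?s \<le> n'"
    using independence_number_le_order[OF fin(1)] super_domination_number_le_order[OF fin(2)]
      assms(3,6) by simp_all

  have "super_domination_number ?P \<le> n * n' - ?a * (n' - ?s)"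
  proof -
    obtain A where A: "independent_set G A" "card A = ?a"
      using maximum_independent_set_exists[OF fin(1)] .
    obtain D where D: "super_dominating H D" "card D = ?s"
      using minimum_super_dominating_set_exists[OF fin(2)] .
    have AG: "A \<subseteq> pverts G" and DH: "D \<subseteq> pverts H"
      using A D by (auto simp: independent_set_def super_dominating_def)
    have finAD: "finite A" "finite D"
      using finite_subset[OF AG fin(1)] finite_subset[OF DH fin(2)] by auto
    have "card (A \<times> (pverts H - D)) = ?a * (n' - ?s)"
      using A D DH finAD assms(6) by (simp add: card_cartesian_product card_Diff_subset)
    then have "card (pverts G \<times> pverts H - A \<times> (pverts H - D)) = n * n' - ?a * (n' - ?s)"
      using AG fin finAD assms(3,6)
      by (subst card_Diff_subset) (auto simp: card_cartesian_product)
    then show ?thesis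
      using super_domination_number_le[OF finP
          super_dominating_lex_product_over_independent[OF assms(1,4) A(1) D(1)]] by simp
  qed
  moreover have "n * n' - ?a * (n' - ?s) \<le> super_domination_number ?P"
  proof -
    obtain E where E: "super_dominating ?P E" "card E = super_domination_number ?P"
      using minimum_super_dominating_set_exists[OF finP] .
    have EP: "E \<subseteq> pverts G \<times> pverts H"
      using E(1) by (simp add: super_dominating_def pverts_lex_product)
    then have "finite E" using fin finite_subset by blast
    then have "card (pverts G \<times> pverts H - E) = n * n' - card E"
      using EP assms(3,6) by (simp add: card_Diff_subset card_cartesian_product)
    moreover have "card (pverts G \<times> pverts H - E) \<le> ?a * (n' - ?s)"
      using card_complement_super_dominating_lex_product_le[OF assms(1,4) E(1)] assms(6,7)
      by simp
    ultimately show ?thesis using E(2) by linarith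
  qed
  moreover have "n * n' - ?a * (n' - ?s) = ?a * ?s + (n - ?a) * n'"
  proof -
    obtain p q where "n = ?a + p" "n' = ?s + q"
      using a s by (metis le_add_diff_inverse)
    then show ?thesis by (simp add: algebra_simps)
  qed
  ultimately show ?thesis by simp
qed

end
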